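(* Let $\lambda>-1/2$, $z>0$, and let $\mathbf{s}_m=\int_{-1}^{1}x^m(1-x^2)^{\lambda-1/2}e^{-zx^2}\,dx$ for $m\ge0$. Then for every $n\ge0$, $$\mathbf{s}_{2n}=\frac{\Gamma(n+1/2)\,\Gamma(\lambda+1/2)}{\Gamma(\lambda+n+1)}\;{}_1F_1\left(n+\tfrac12;\lambda+n+1,-z\right),\qquad \mathbf{s}_{2n+1}=0.$$
   Context: ${}_1F_1(a;b,x)=\sum_{k=0}^{\infty}\frac{(a)_k}{(b)_k}\frac{x^k}{k!}$ is the confluent hypergeometric function, where $(a)_0=1$ and $(a)_k=a(a+1)\cdots(a+k-1)$ for $k\ge1$. *)

theory Defs
  imports "HOL-Analysis.Analysis" "HOL-Real_Asymp.Real_Asymp"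
begin

definition hyp1F1 :: "real \<Rightarrow> real \<Rightarrow> real \<Rightarrow> real" where
  "hyp1F1 a b x = (\<Sum>k. pochhammer a k / pochhammer b k * (x ^ k / fact k))"

text \<open>
  The infinite sum above is a genuine limit for all arguments. (For \<open>b\<close> a non-positive
  integer, where the function is not defined mathematically, the convention \<open>c / 0 = 0\<close>
  truncates the series.)
\<close>

lemma summable_hyp1F1:
  fixes a b x :: real
  shows "summable (\<lambda>k. pochhammer a k / pochhammer b k * (x ^ k / fact k))"
proof -
  define t where "t = (\<lambda>k. pochhammer a k / pochhammer b k * (x ^ k / fact k))"
  define r where "r = (\<lambda>k. \<bar>(a + real k) / (b + real k) * (x / (real k + 1))\<bar>)"
  have "t (Suc k) = (a + real k) / (b + real k) * (x / (real k + 1)) * t k" for k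
    by (simp add: t_def pochhammer_Suc mult_ac add_ac)
  then have t_Suc: "norm (t (Suc k)) = r k * norm (t k)" for k
    by (simp only: r_def real_norm_def abs_mult)
  have "(\<lambda>k. (a + real k) / (b + real k)) \<longlonglongrightarrow> 1"
    by real_asymp
  moreover have "(\<lambda>k. x * (1 / (real k + 1))) \<longlonglongrightarrow> x * 0"
    by (intro tendsto_mult tendsto_const) real_asymp
  ultimately have "(\<lambda>k. (a + real k) / (b + real k) * (x * (1 / (real k + 1)))) \<longlonglongrightarrow> 1 * (x * 0)"
    by (rule tendsto_mult)
  then have "r \<longlonglongrightarrow> 0"
    unfolding r_def by (intro tendsto_rabs_zero) simp
  then have "eventually (\<lambda>k. r k < 1/2) sequentially"
    by (rule order_tendstoD(2)) simp
  then obtain N where N: "\<And>k. k \<ge> N \<Longrightarrow> r k < 1/2"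
    unfolding eventually_sequentially by blast
  have "norm (t (Suc k)) \<le> 1/2 * norm (t k)" if "k \<ge> N" for k
    unfolding t_Suc using N[OF that] by (intro mult_right_mono) auto
  then have "summable t"
    by (intro summable_ratio_test[of "1/2" N t]) auto
  then show ?thesis
    by (simp add: t_def)
qed

text \<open>
  On \<open>[-1, 1]\<close> the base \<open>1 - x\<^sup>2\<close> is nonnegative. At the endpoints \<open>0 powr c = 0\<close>,
  whatever \<open>c\<close> is; this is a null set and does not affect the integral.
\<close>

definition moment_integrand :: "real \<Rightarrow> real \<Rightarrow> nat \<Rightarrow> real \<Rightarrow> real" where
  "moment_integrand lam z m x =
     x ^ m * (1 - x\<^sup>2) powr (lam - 1/2) * exp (- z * x\<^sup>2)"

definition moment :: "real \<Rightarrow> real \<Rightarrow> nat \<Rightarrow> real" where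
  "moment lam z m = (LBINT x:{-1..1}. moment_integrand lam z m x)"

end

theory Submission
  imports Defs
begin

text \<open>
  The substitution \<open>t = x\<^sup>2\<close> turns the even moments into the Euler integral
  \<open>\<integral>\<^sub>0\<^sup>1 t\<^sup>a\<^sup>-\<^sup>1 (1 - t)\<^sup>b\<^sup>-\<^sup>1 e\<^sup>w\<^sup>t dt\<close> with \<open>a = n + 1/2\<close>, \<open>b = \<lambda> + 1/2\<close> and \<open>w = -z\<close>.
  Expanding the exponential and integrating termwise gives a series of Beta values, whose ratios
  \<open>B(a + k, b) / B(a, b) = (a)\<^sub>k / (a + b)\<^sub>k\<close> are the coefficients of \<open>\<^sub>1F\<^sub>1(a; a + b, w)\<close>.
  The odd moments vanish by symmetry.
\<close>

lemma set_integral_Beta_real: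
  fixes a b :: real
  assumes "a > 0" "b > 0"
  shows "(LBINT t:{0..1}. t powr (a - 1) * (1 - t) powr (b - 1)) = Beta a b"
  using set_borel_integral_eq_integral(2)[OF integrable_Beta[OF assms]]
    has_integral_Beta_real[OF assms] by (simp add: integral_unique)

text \<open>Each Pochhammer symbol is a quotient of Gamma values, and the factor
  \<open>Gamma b\<close> is common to both Beta values. Positivity keeps \<open>a\<close> and
  \<open>a + b\<close> away from the poles of Gamma.\<close>

lemma Beta_plus_of_nat_left:
  fixes a b :: real
  assumes "a > 0" "b > 0"
  shows "Beta (a + real k) b = Beta a b * (pochhammer a k / pochhammer (a + b) k)"
proof -
  have "a \<notin> \<int>\<^sub>\<le>\<^sub>0" "a + b \<notin> \<int>\<^sub>\<le>\<^sub>0"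
    using assms by (auto elim!: nonpos_Ints_cases)
  moreover from this have "Gamma a \<noteq> 0" "Gamma (a + b) \<noteq> 0"
    by (simp_all add: Gamma_eq_zero_iff)
  ultimately show ?thesis
    by (simp add: pochhammer_Gamma Beta_def add_ac)
qed

lemma powr_Beta_mult_power:
  fixes a b t :: real
  assumes "t \<ge> 0"
  shows "t ^ k * (t powr (a - 1) * (1 - t) powr (b - 1))
           = t powr (a + real k - 1) * (1 - t) powr (b - 1)"
\<comment> \<open>At \<open>t = 0\<close> both sides vanish because \<open>0 powr c = 0\<close> for
  every \<open>c\<close>; merging the exponents needs \<open>t > 0\<close>.\<close>
proof (cases "t = 0")
  case False
  then have "t ^ k * t powr (a - 1) = t powr (a + real k - 1)"
    using assms by (simp add: powr_realpow[symmetric] powr_add[symmetric] algebra_simps)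
  then show ?thesis
    by (simp flip: mult.assoc)
qed simp

lemma Euler_integral_hyp1F1:
  fixes a b w :: real
  assumes "a > 0" "b > 0"
  shows "set_integrable lborel {0..1} (\<lambda>t. t powr (a - 1) * (1 - t) powr (b - 1) * exp (w * t))"
      (is "set_integrable _ _ ?g")
    and "(LBINT t:{0..1}. t powr (a - 1) * (1 - t) powr (b - 1) * exp (w * t))
           = Beta a b * hyp1F1 a (a + b) w"
proof -
  define f where "f = (\<lambda>k t. indicator {0..1} t *\<^sub>R
    (w ^ k / fact k * (t powr (a + real k - 1) * (1 - t) powr (b - 1))))"
  \<comment> \<open>The argument \<open>y\<close> is kept free: \<open>y = w\<close> gives the
    integral of \<open>f k\<close>, and \<open>y = \<bar>w\<bar>\<close> that of its norm, since the
    Beta weight is nonnegative on \<open>{0..1}\<close>.\<close>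
  define c where "c = (\<lambda>y k. Beta a b * (pochhammer a k / pochhammer (a + b) k * (y ^ k / fact k)))"
  have integrable: "integrable lborel (f k)" for k
    using set_integrable_mult_right[OF integrable_Beta[of "a + real k" b]] assms
    unfolding f_def set_integrable_def by auto
  have int_f: "integral\<^sup>L lborel (f k) = c w k" for k
  proof -
    have "integral\<^sup>L lborel (f k) = w ^ k / fact k * Beta (a + real k) b"
      using set_integral_mult_right[of lborel "{0..1}" "w ^ k / fact k"
          "\<lambda>t. t powr (a + real k - 1) * (1 - t) powr (b - 1)"]
        set_integral_Beta_real[of "a + real k" b] assms
      unfolding f_def set_lebesgue_integral_def by simp
    then show ?thesis
      using assms by (simp add: Beta_plus_of_nat_left c_def mult_ac)
  qed
  have int_norm: "(\<integral>t. norm (f k t) \<partial>lborel) = c \<bar>w\<bar> k" for k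
  proof -
    have "(\<lambda>t. norm (f k t)) = (\<lambda>t. indicator {0..1} t *\<^sub>R
        (\<bar>w\<bar> ^ k / fact k * (t powr (a + real k - 1) * (1 - t) powr (b - 1))))"
      by (auto simp: f_def abs_mult power_abs indicator_def)
    then have "(\<integral>t. norm (f k t) \<partial>lborel) = \<bar>w\<bar> ^ k / fact k * Beta (a + real k) b"
      using set_integral_mult_right[of lborel "{0..1}" "\<bar>w\<bar> ^ k / fact k"
          "\<lambda>t. t powr (a + real k - 1) * (1 - t) powr (b - 1)"]
        set_integral_Beta_real[of "a + real k" b] assms
      unfolding set_lebesgue_integral_def by simp
    then show ?thesis
      using assms by (simp add: Beta_plus_of_nat_left c_def mult_ac)
  qed
  let ?h = "\<lambda>t. indicator {0..1} t * (t powr (a - 1) * (1 - t) powr (b - 1))"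
  have f_eq: "f k t = ?h t * ((w * t) ^ k /\<^sub>R fact k)" for k t
    using powr_Beta_mult_power[of t k a b, symmetric]
    by (auto simp: f_def indicator_def power_mult_distrib field_simps)
  have sums_f: "(\<lambda>k. f k t) sums (indicator {0..1} t *\<^sub>R ?g t)" for t
    using sums_mult[OF exp_converges[of "w * t"], of "?h t"]
    unfolding f_eq by (simp add: mult_ac)
  have summable_norm: "summable (\<lambda>k. norm (f k t))" for t
    using summable_mult[OF summable_norm_exp[of "w * t"],
        of "norm (?h t)"]
    by (simp only: f_eq norm_mult[of "?h t"])
  \<comment> \<open>Convergence of the hypergeometric series at \<open>\<bar>w\<bar>\<close> is what
    permits exchanging sum and integral.\<close>
  have summable_int: "summable (\<lambda>k. \<integral>t. norm (f k t) \<partial>lborel)"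
    unfolding int_norm c_def by (intro summable_mult summable_hyp1F1)
  have g_eq: "(\<lambda>t. \<Sum>k. f k t) = (\<lambda>t. indicator {0..1} t *\<^sub>R ?g t)"
    using sums_f by (auto simp: sums_iff)
  show "set_integrable lborel {0..1} ?g"
    using integrable_suminf[OF integrable AE_I2[OF summable_norm] summable_int]
    unfolding set_integrable_def g_eq .
  show "(LBINT t:{0..1}. ?g t) = Beta a b * hyp1F1 a (a + b) w"
    using integral_suminf[OF integrable AE_I2[OF summable_norm] summable_int]
    unfolding set_lebesgue_integral_def g_eq int_f
    by (simp only: c_def hyp1F1_def suminf_mult[OF summable_hyp1F1])
qed

lemma borel_measurable_moment_integrand [measurable]:
  "moment_integrand lam z m \<in> borel_measurable borel"
  unfolding moment_integrand_def by measurable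

lemma moment_integrand_uminus:
  "moment_integrand lam z m (- x) = (- 1) ^ m * moment_integrand lam z m x"
  by (simp add: moment_integrand_def power_minus[of x])

text \<open>The map \<open>x \<mapsto> x\<^sup>2\<close> is increasing on \<open>{0..1}\<close>, so
  the substitution is made on this half only. The factor 2 comes from \<open>dt = 2 * x dx\<close>,
  and \<open>lam + real n + 1\<close> is the sum of the two Beta parameters.\<close>

lemma moment_integrand_even_half:
  fixes lam z :: real
  assumes "lam > - 1/2"
  shows "set_integrable lborel {0..1} (moment_integrand lam z (2 * n))"
    and "2 * (LBINT x:{0..1}. moment_integrand lam z (2 * n) x)
           = Beta (real n + 1/2) (lam + 1/2) * hyp1F1 (real n + 1/2) (lam + real n + 1) (- z)"
proof -
  define f where "f = (\<lambda>t. t powr (real n + 1/2 - 1) * (1 - t) powr (lam + 1/2 - 1) * exp ((- z) * t))"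
  have pos: "real n + 1/2 > 0" "lam + 1/2 > 0"
    using assms by auto
  have f: "set_integrable lborel {0..1} f"
    using Euler_integral_hyp1F1(1)[OF pos, of "- z"] by (simp add: f_def)
  have deriv: "((\<lambda>x. x\<^sup>2) has_real_derivative 2 * x) (at x)" for x :: real
    by (auto intro!: derivative_eq_intros)
  have cont: "continuous_on {0..1} (\<lambda>x::real. 2 * x)"
    by (intro continuous_intros)
  have subst: "set_integrable lborel {0..1} (\<lambda>x. f (x\<^sup>2) * (2 * x))"
    "(LBINT t:{0..1}. f t) = (LBINT x:{0..1}. f (x\<^sup>2) * (2 * x))"
    using integral_substitution[of "\<lambda>x. x\<^sup>2" 0 1 f "\<lambda>x. 2 * x"] f deriv cont
    by (auto simp: set_lebesgue_integral_def mult_ac)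
  \<comment> \<open>The two sides differ at \<open>0\<close> for \<open>n = 0\<close>, because \<open>0 powr c = 0\<close>.\<close>
  have eq: "f (x\<^sup>2) * (2 * x) = 2 * moment_integrand lam z (2 * n) x" if "x > 0" for x
  proof -
    \<comment> \<open>The factor \<open>x\<close> from the derivative raises the exponent
      \<open>2 * n - 1\<close> to \<open>2 * n\<close>.\<close>
    have "(x\<^sup>2) powr (real n + 1/2 - 1) * x = x powr (2 * (real n + 1/2 - 1) + 1)"
      using that by (simp add: powr_powr powr_mult_base mult.commute[of _ x] flip: powr_numeral)
    also have "\<dots> = x ^ (2 * n)"
      using that by (simp flip: powr_realpow)
    finally show ?thesis
      by (simp add: f_def moment_integrand_def)
  qed
  have [measurable]: "f \<in> borel_measurable borel"
    unfolding f_def by measurable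
  have "AE x in lborel. x \<noteq> (0::real)"
    by (rule AE_lborel_singleton)
  then have AE: "AE x\<in>{0..1} in lborel. f (x\<^sup>2) * (2 * x) = 2 * moment_integrand lam z (2 * n) x"
    by eventually_elim (simp add: eq del: mult_cancel_left)
  have "set_integrable lborel {0..1} (\<lambda>x. 2 * moment_integrand lam z (2 * n) x)
      \<longleftrightarrow> set_integrable lborel {0..1} (\<lambda>x. f (x\<^sup>2) * (2 * x))"
    using AE by (intro set_integrable_cong_AE) auto
  then show "set_integrable lborel {0..1} (moment_integrand lam z (2 * n))"
    using subst(1) by simp
  have "2 * (LBINT x:{0..1}. moment_integrand lam z (2 * n) x)
      = (LBINT x:{0..1}. 2 * moment_integrand lam z (2 * n) x)"
    by simp
  also have "\<dots> = (LBINT x:{0..1}. f (x\<^sup>2) * (2 * x))"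
    using AE by (intro set_lebesgue_integral_cong_AE) auto
  also have "\<dots> = (LBINT t:{0..1}. f t)"
    by (rule subst(2)[symmetric])
  also have "\<dots> = Beta (real n + 1/2) (lam + 1/2) * hyp1F1 (real n + 1/2) (lam + real n + 1) (- z)"
    using Euler_integral_hyp1F1(2)[OF pos, of "- z"] by (simp add: f_def add_ac)
  finally show "2 * (LBINT x:{0..1}. moment_integrand lam z (2 * n) x) = \<dots>" .
qed

text \<open>For \<open>m = 0\<close> the integrand is even, so integrability on
  \<open>{0..1}\<close> reflects to \<open>{-1..0}\<close>. It dominates every other
  \<open>m\<close>, as \<open>\<bar>x\<bar> ^ m \<le> 1\<close> on the interval.\<close>

lemma set_integrable_moment_integrand:
  assumes "lam > - 1/2"
  shows "set_integrable lborel {-1..1} (moment_integrand lam z m)"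
proof -
  have pos: "set_integrable lborel {0..1} (moment_integrand lam z 0)"
    using moment_integrand_even_half(1)[OF assms, of z 0] by simp
  have "(\<lambda>x. indicator {0..1} (- x) *\<^sub>R moment_integrand lam z 0 (- x))
      = (\<lambda>x. indicator {-1..0} x *\<^sub>R moment_integrand lam z 0 x)"
    by (auto simp: moment_integrand_uminus indicator_def)
  then have "set_integrable lborel {-1..0} (moment_integrand lam z 0)"
    using lborel_integrable_real_affine[OF pos[unfolded set_integrable_def], of "-1" 0]
    by (simp add: set_integrable_def)
  from set_integrable_Un[OF this pos] have "set_integrable lborel {-1..1} (moment_integrand lam z 0)"
    by (simp add: ivl_disj_un_two_touch)
  moreover have "norm (moment_integrand lam z m x) \<le> norm (moment_integrand lam z 0 x)"
    if "x \<in> {-1..1}" for x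
  proof -
    have "\<bar>x\<bar> ^ m * \<bar>moment_integrand lam z 0 x\<bar> \<le> \<bar>moment_integrand lam z 0 x\<bar>"
      using that by (intro mult_left_le_one_le power_le_one) auto
    then show ?thesis
      by (simp add: moment_integrand_def abs_mult power_abs)
  qed
  ultimately show ?thesis
    by (intro set_integrable_bound[of lborel _ "moment_integrand lam z 0" "moment_integrand lam z m"] AE_I2)
      (simp_all add: set_borel_measurable_def)
qed

text \<open>Reflection at 0 multiplies the integrand by \<open>(- 1) ^ m\<close>, so the two halves
  add up for even \<open>m\<close> and cancel for odd \<open>m\<close>.\<close>

lemma moment_eq_half:
  assumes "lam > - 1/2"
  shows "moment lam z m = (1 + (- 1) ^ m) * (LBINT x:{0..1}. moment_integrand lam z m x)"
proof -
  have int: "set_integrable lborel {0..1} (moment_integrand lam z m)"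
    "set_integrable lborel {-1..0} (moment_integrand lam z m)"
    by (auto intro!: set_integrable_subset[OF set_integrable_moment_integrand[OF assms]])
  have "AE x in lborel. x \<noteq> (0::real)"
    by (rule AE_lborel_singleton)
  \<comment> \<open>The closed halves overlap only in the null set \<open>{0}\<close>.\<close>
  then have "AE x in lborel. \<not> (x \<in> {-1..0} \<and> x \<in> {0..1::real})"
    by eventually_elim auto
  from set_integral_Un_AE[OF this _ _ int(2,1)]
  have "moment lam z m = (LBINT x:{-1..0}. moment_integrand lam z m x)
      + (LBINT x:{0..1}. moment_integrand lam z m x)"
    by (simp add: moment_def ivl_disj_un_two_touch)
  moreover have "{x. - x \<in> {-1..0}} = {0..1::real}"
    by auto
  then have "(LBINT x:{-1..0}. moment_integrand lam z m x)
      = (- 1) ^ m * (LBINT x:{0..1}. moment_integrand lam z m x)"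
    by (subst set_integral_reflect) (simp add: moment_integrand_uminus)
  ultimately show ?thesis
    by (simp add: algebra_simps)
qed

theorem proposition3p2:
  fixes lam z :: real
  assumes "lam > - 1/2" and "z > 0"
  shows "(\<forall>m. set_integrable lborel {-1..1} (moment_integrand lam z m)) \<and>
         (\<forall>n. moment lam z (2 * n) =
                Gamma (real n + 1/2) * Gamma (lam + 1/2) / Gamma (lam + real n + 1)
                  * hyp1F1 (real n + 1/2) (lam + real n + 1) (- z) \<and>
              moment lam z (2 * n + 1) = 0)"
  \<comment> \<open>The factor \<open>1 + (- 1) ^ m\<close> is 2 at even indices, which matches the
    doubled half integral, and 0 at odd ones.\<close>
  using assms(1) moment_integrand_even_half(2)[OF assms(1), of z]
  by (auto simp: set_integrable_moment_integrand moment_eq_half Beta_def add_ac)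

end
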